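(* Let $\delta>0$ be given. Let $f$ be a real-valued function (defined on $[0,+\infty)$) such that, on $[\delta,+\infty)$, $f$ is increasing and differentiable, with $f'$ non-increasing (respectively, decreasing). Let $f(0)=0$, and let $f$ be twice differentiable at $\delta$. If $$f''(\delta)\ \geq\ \frac{2}{\delta}\left(f'(\delta)-\frac{f(\delta)}{\delta}\right),$$ then the smoothing $g$ of $f$ associated with $\delta$ is increasing and concave (respectively, increasing and strictly concave) on $[0,+\infty)$.
   Context: Conventions: "increasing" and "decreasing" are meant strictly, as opposed to "non-decreasing" and "non-increasing". Definition of the smoothing $g$ of $f$ associated with $\delta>0$: $g(w):=f(w)$ for $w\in[\delta,+\infty)$, and $g(w):=Aw^3+Bw^2+Cw$ for $w\in[0,\delta]$, where $$A=\frac{f(\delta)}{\delta^3}-\frac{f'(\delta)}{\delta^2}+\frac{f''(\delta)}{2\delta},\qquad B=-\frac{3f(\delta)}{\delta^2}+\frac{3f'(\delta)}{\delta}-f''(\delta),\qquad C=\frac{3f(\delta)}{\delta}-2f'(\delta)+\frac{\delta f''(\delta)}{2}.$$ (These are the unique constants for which the cubic $Aw^3+Bw^2+Cw$ agrees with $f$ in value, first derivative and second derivative at $w=\delta$.)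
   Formalization: Strict concavity of g is claimed only when f'(δ) = f(δ)/δ and f''(δ) = 0 do not both hold; in that excluded case g is linear on [0,δ], so the claim as stated fails (δ=1, f(w)=w on [0,1], f(w)=1+arctan(w−1) for w≥1). *)

theory Defs
  imports "HOL-Analysis.Analysis"
begin

(* Differentiability near x is required first because deriv returns an arbitrary value
   at points where the derivative does not exist. *)
definition twice_differentiable_at :: "(real \<Rightarrow> real) \<Rightarrow> real \<Rightarrow> bool" where
  "twice_differentiable_at f x \<longleftrightarrow>
     (\<forall>\<^sub>F y in nhds x. f differentiable (at y)) \<and> deriv f differentiable (at x)"

definition strictly_concave_on :: "real set \<Rightarrow> (real \<Rightarrow> real) \<Rightarrow> bool" where
  "strictly_concave_on S f \<longleftrightarrow> convex S \<and>
     (\<forall>x\<in>S. \<forall>y\<in>S. \<forall>t. x \<noteq> y \<and> 0 < t \<and> t < 1 \<longrightarrow>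
        (1 - t) * f x + t * f y < f ((1 - t) * x + t * y))"

(* The unique coefficients for which A w^3 + B w^2 + C w agrees with f at d in value,
   first derivative and second derivative. *)
definition coeff_A :: "(real \<Rightarrow> real) \<Rightarrow> real \<Rightarrow> real" where
  "coeff_A f d = f d / d ^ 3 - deriv f d / d ^ 2 + deriv (deriv f) d / (2 * d)"

definition coeff_B :: "(real \<Rightarrow> real) \<Rightarrow> real \<Rightarrow> real" where
  "coeff_B f d = - (3 * f d / d ^ 2) + 3 * deriv f d / d - deriv (deriv f) d"

definition coeff_C :: "(real \<Rightarrow> real) \<Rightarrow> real \<Rightarrow> real" where
  "coeff_C f d = 3 * f d / d - 2 * deriv f d + d * deriv (deriv f) d / 2"

(* Only arguments w \<ge> 0 are meaningful; the cubic is used for w < 0 merely to have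
   a total function. *)
definition smoothing :: "(real \<Rightarrow> real) \<Rightarrow> real \<Rightarrow> real \<Rightarrow> real" where
  "smoothing f d w =
     (if d \<le> w then f w
      else coeff_A f d * w ^ 3 + coeff_B f d * w ^ 2 + coeff_C f d * w)"

(* The two pieces agree at the common point d, so the conditional is unambiguous. *)
lemma smoothing_cubic:
  assumes "d > 0" "w \<le> d"
  shows "smoothing f d w = coeff_A f d * w ^ 3 + coeff_B f d * w ^ 2 + coeff_C f d * w"
proof (cases "w = d")
  case True
  then show ?thesis using assms
    by (simp add: smoothing_def coeff_A_def coeff_B_def coeff_C_def field_simps
        power2_eq_square power3_eq_cube)
next
  case False
  then show ?thesis using assms by (simp add: smoothing_def)
qed

end

theory Submission
  imports Defs
begin

(* On [0, \<delta>] the second derivative of the cubic is affine, with value f''(\<delta>) <= 0 at \<delta> and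
   value 6 (f'(\<delta>) - f(\<delta>)/\<delta>)/\<delta> - 2 f''(\<delta>) <= f''(\<delta>) at 0, the latter inequality being exactly
   the hypothesis. So g' is non-increasing on [0, \<infinity>). It is positive on [\<delta>, \<infinity>) by the mean value
   theorem for f, hence everywhere. In the strict case the second derivative of the cubic can only
   fail to be negative on [0, \<delta>) if it vanishes identically, which is the excluded case. *)

section \<open>Monotonicity and concavity read off from the derivative\<close>

text \<open>By the mean value theorem the chords from x to z and from z to y have slopes
  \<open>g' u\<close> and \<open>g' v\<close> with u < z < v, and g lies above the long chord at z
  by t (1 - t) (y - x) (\<open>g' u\<close> - \<open>g' v\<close>).\<close>

lemma strictly_concave_on_realI:
  fixes g :: "real \<Rightarrow> real"
  assumes S: "convex S"
    and deriv: "\<And>x. x \<in> S \<Longrightarrow> (g has_real_derivative g' x) (at x)"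
    and anti: "strict_antimono_on S g'"
  shows "strictly_concave_on S g"
proof -
  have between: "(1 - t) * g x + t * g y < g ((1 - t) * x + t * y)"
    if x: "x \<in> S" and y: "y \<in> S" and xy: "x < y" and t: "0 < t" "t < 1" for x y t
  proof -
    define z where "z = (1 - t) * x + t * y"
    have zx: "z - x = t * (y - x)" and yz: "y - z = (1 - t) * (y - x)"
      by (simp_all add: z_def algebra_simps)
    have z: "x < z" "z < y"
      using xy t zx yz by (metis diff_gt_0_iff_gt mult_pos_pos)+
    have S': "w \<in> S" if "x \<le> w" "w \<le> y" for w
      using S x y that unfolding is_interval_convex_1[symmetric] is_interval_1 by blast
    obtain u where u: "x < u" "u < z" "g z - g x = (z - x) * g' u"
      using MVT2[OF z(1), of g g'] deriv[OF S'] z by (metis less_imp_le order_trans)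
    obtain v where v: "z < v" "v < y" "g y - g z = (y - z) * g' v"
      using MVT2[OF z(2), of g g'] deriv[OF S'] z by (metis less_imp_le order_trans)
    have "g' v < g' u"
      using monotone_onD[OF anti S' S', of u v] u v z by simp
    moreover have "g z - ((1 - t) * g x + t * g y) = (1 - t) * (g z - g x) - t * (g y - g z)"
      by (simp add: algebra_simps)
    then have "g z - ((1 - t) * g x + t * g y) = t * (1 - t) * (y - x) * (g' u - g' v)"
      unfolding u(3) v(3) zx yz by (simp add: algebra_simps)
    ultimately have "g z - ((1 - t) * g x + t * g y) > 0"
      using t xy by simp
    then show ?thesis by (simp add: z_def)
  qed
  show ?thesis
    unfolding strictly_concave_on_def
  proof (intro conjI ballI allI impI S)
    fix x y t :: real
    assume "x \<in> S" "y \<in> S" "x \<noteq> y \<and> 0 < t \<and> t < 1"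
    then show "(1 - t) * g x + t * g y < g ((1 - t) * x + t * y)"
      \<comment> \<open>For y < x, swap the endpoints and replace t by 1 - t.\<close>
      using between[of x y t] between[of y x "1 - t"]
      by (cases x y rule: linorder_cases) (auto simp: add.commute)
  qed
qed

lemma concave_on_realI:
  fixes g :: "real \<Rightarrow> real"
  assumes "convex S"
    and "\<And>x. x \<in> S \<Longrightarrow> (g has_real_derivative g' x) (at x)"
    and "antimono_on S g'"
  shows "concave_on S g"
  unfolding concave_on_def
proof (rule convex_on_realI)
  show "connected S" using assms(1) by (rule convex_connected)
  show "((\<lambda>x. - g x) has_real_derivative - g' x) (at x)" if "x \<in> S" for x
    using assms(2)[OF that] by (rule DERIV_minus)
  show "- g' x \<le> - g' y" if "x \<in> S" "y \<in> S" "x \<le> y" for x y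
    using assms(3) that by (auto simp: monotone_on_def)
qed

lemma strict_mono_on_realI:
  fixes g :: "real \<Rightarrow> real"
  assumes S: "convex S"
    and deriv: "\<And>x. x \<in> S \<Longrightarrow> (g has_real_derivative g' x) (at x)"
    and pos: "\<And>x. x \<in> S \<Longrightarrow> g' x > 0"
  shows "strict_mono_on S g"
proof (rule strict_mono_onI)
  fix x y assume xy: "x \<in> S" "y \<in> S" "x < y"
  have "w \<in> S" if "x \<le> w" "w \<le> y" for w
    using S xy that unfolding is_interval_convex_1[symmetric] is_interval_1 by blast
  then show "g x < g y"
    using DERIV_pos_imp_increasing[OF xy(3), of g] deriv pos by blast
qed

section \<open>The derivative of the smoothing\<close>

text \<open>The quadratic also serves for w < 0, so that the smoothing has a two-sided derivative at
  0 too.\<close>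

definition smoothing_deriv :: "(real \<Rightarrow> real) \<Rightarrow> real \<Rightarrow> real \<Rightarrow> real" where
  "smoothing_deriv f d w =
     (if d \<le> w then deriv f w
      else 3 * coeff_A f d * w ^ 2 + 2 * coeff_B f d * w + coeff_C f d)"

text \<open>At w = d this is the matching of first derivatives for which the coefficients are
  chosen.\<close>

lemma smoothing_deriv_quadratic:
  assumes "d > 0" "w \<le> d"
  shows "smoothing_deriv f d w = 3 * coeff_A f d * w ^ 2 + 2 * coeff_B f d * w + coeff_C f d"
proof (cases "w = d")
  case True
  then show ?thesis using assms
    by (simp add: smoothing_deriv_def coeff_A_def coeff_B_def coeff_C_def field_simps
        power2_eq_square power3_eq_cube)
next
  case False
  then show ?thesis using assms by (simp add: smoothing_deriv_def)
qed

lemma has_real_derivative_smoothing: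
  assumes d: "d > 0" and f: "\<And>w. d \<le> w \<Longrightarrow> f differentiable (at w)"
  shows "(smoothing f d has_real_derivative smoothing_deriv f d w) (at w)"
proof -
  let ?p = "\<lambda>w. coeff_A f d * w ^ 3 + coeff_B f d * w ^ 2 + coeff_C f d * w"
  have right: "(f has_real_derivative smoothing_deriv f d w) (at w)" if "d \<le> w"
    using f[OF that] that
    by (simp add: smoothing_deriv_def DERIV_deriv_iff_real_differentiable)
  have left: "(?p has_real_derivative smoothing_deriv f d w) (at w)" if "w \<le> d"
    unfolding smoothing_deriv_quadratic[OF d that]
    by (auto intro!: derivative_eq_intros)
  consider "w < d" | "w = d" | "d < w" by linarith
  then show ?thesis
  proof cases
    case 1
    then have "(?p has_real_derivative smoothing_deriv f d w) (at w)" by (intro left) simp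
    then show ?thesis
      by (rule has_field_derivative_transform_within_open[where S = "{..<d}"])
        (use 1 in \<open>auto simp: smoothing_def\<close>)
  next
    case 3
    then have "(f has_real_derivative smoothing_deriv f d w) (at w)" by (intro right) simp
    then show ?thesis
      by (rule has_field_derivative_transform_within_open[where S = "{d<..}"])
        (use 3 in \<open>auto simp: smoothing_def\<close>)
  next
    case 2
    \<comment> \<open>At the joint, each one-sided derivative comes from the piece that equals the
      smoothing on that closed half-line. The two limits agree, and the half-lines cover the real
      line.\<close>
    have "(smoothing f d has_real_derivative smoothing_deriv f d w) (at w within {..d})"
      unfolding has_field_derivative_def
      by (rule has_derivative_transform[OF _ _
            has_field_derivative_at_within[OF left, unfolded has_field_derivative_def]])
        (use 2 d in \<open>auto simp: smoothing_cubic\<close>)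
    moreover have "(smoothing f d has_real_derivative smoothing_deriv f d w) (at w within {d..})"
      unfolding has_field_derivative_def
      by (rule has_derivative_transform[OF _ _
            has_field_derivative_at_within[OF right, unfolded has_field_derivative_def]])
        (use 2 in \<open>auto simp: smoothing_def\<close>)
    ultimately have "(smoothing f d has_real_derivative smoothing_deriv f d w)
        (at w within {..d} \<union> {d..})"
      unfolding has_field_derivative_iff by (rule Lim_Un)
    moreover have "{..d} \<union> {d..} = UNIV" by auto
    ultimately show ?thesis by simp
  qed
qed

section \<open>Signs of the first and second derivatives of \<open>f\<close>\<close>

text \<open>A positive derivative would make h increase just to the right of a. Taking
  \<open>deriv f\<close> for h gives the sign of f'' at the joint.\<close>

lemma antimono_on_deriv_nonpos:
  fixes h :: "real \<Rightarrow> real"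
  assumes h: "(h has_real_derivative l) (at a)" and anti: "antimono_on {a..} h"
  shows "l \<le> 0"
proof (rule ccontr)
  assume "\<not> l \<le> 0"
  then obtain e where "e > 0" and e: "\<And>k. 0 < k \<Longrightarrow> k < e \<Longrightarrow> h a < h (a + k)"
    using DERIV_pos_inc_right[OF h] by auto
  then have "h a < h (a + e / 2)" by simp
  moreover have "h (a + e / 2) \<le> h a"
    using anti \<open>e > 0\<close> by (auto simp: monotone_on_def)
  ultimately show False by simp
qed

text \<open>Strict monotonicity alone allows zeros of f'. But the mean value theorem on [w, w + 1]
  gives u > w with f'(u) > 0, and f'(w) >= f'(u).\<close>

lemma deriv_pos_if_strict_mono_on_antimono_on:
  fixes f :: "real \<Rightarrow> real"
  assumes mono: "strict_mono_on {a..} f"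
    and f: "\<And>w. a \<le> w \<Longrightarrow> f differentiable (at w)"
    and anti: "antimono_on {a..} (deriv f)"
    and w: "a \<le> w"
  shows "deriv f w > 0"
proof -
  have "\<exists>u>w. u < w + 1 \<and> f (w + 1) - f w = (w + 1 - w) * deriv f u"
    by (rule MVT2) (use f w in \<open>auto simp: DERIV_deriv_iff_real_differentiable\<close>)
  then obtain u where u: "u > w" "f (w + 1) - f w = deriv f u" by auto
  moreover have "f w < f (w + 1)"
    using mono w by (auto simp: strict_mono_on_def)
  moreover have "deriv f u \<le> deriv f w"
    using anti u(1) w by (auto simp: monotone_on_def)
  ultimately show ?thesis by linarith
qed

section \<open>The second derivative of the cubic\<close>

text \<open>The average of the second derivative of the cubic over \<open>[x, y]\<close> is its value at the midpoint,
  interpolated here between its values at \<open>0\<close> and at \<open>d\<close>.\<close>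

lemma smoothing_deriv_diff:
  assumes d: "d > 0" and xy: "x \<le> d" "y \<le> d"
  shows "d * (smoothing_deriv f d y - smoothing_deriv f d x) =
    (y - x) * ((d - (x + y) / 2) * (6 / d * (deriv f d - f d / d) - 2 * deriv (deriv f) d)
      + (x + y) / 2 * deriv (deriv f) d)"
proof -
  \<comment> \<open>For the cubic p, q = p''(d) and r = p''(0) = 2 B. Since p'' is affine with slope
    6 A, also 6 A d = q - r.\<close>
  define A B q r where "A = coeff_A f d" and "B = coeff_B f d" and "q = deriv (deriv f) d"
    and "r = 6 / d * (deriv f d - f d / d) - 2 * deriv (deriv f) d"
  have B: "2 * B = r"
    using d by (simp add: B_def r_def coeff_B_def field_simps power2_eq_square)
  have A: "6 * A * d = q - r"
    using d by (simp add: A_def q_def r_def coeff_A_def field_simps power2_eq_square power3_eq_cube)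
  have "2 * (d * (smoothing_deriv f d y - smoothing_deriv f d x)) =
      (y - x) * ((6 * A * d) * (x + y) + 2 * (2 * B) * d)"
    unfolding smoothing_deriv_quadratic[OF d xy(1)] smoothing_deriv_quadratic[OF d xy(2)]
    by (simp add: A_def B_def algebra_simps power2_eq_square)
  also have "\<dots> = 2 * ((y - x) * ((d - (x + y) / 2) * r + (x + y) / 2 * q))"
    unfolding A B by (simp add: field_simps)
  finally show ?thesis by (simp add: q_def r_def)
qed

lemma smoothing_deriv_le:
  assumes d: "d > 0" and xy: "0 \<le> x" "x \<le> y" "y \<le> d"
    and q: "deriv (deriv f) d \<le> 0"
    and ge: "deriv (deriv f) d \<ge> 2 / d * (deriv f d - f d / d)"
  shows "smoothing_deriv f d y \<le> smoothing_deriv f d x"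
proof -
  \<comment> \<open>Now r is the lower bound for f''(d) in \<open>ge\<close>; in these terms the
    second derivative of the cubic at 0 is 3 r - 2 f''(d) <= f''(d).\<close>
  define r where "r = 2 / d * (deriv f d - f d / d)"
  have "3 * r - 2 * deriv (deriv f) d \<le> 0"
    using ge q unfolding r_def[symmetric] by linarith
  then have "6 / d * (deriv f d - f d / d) - 2 * deriv (deriv f) d \<le> 0"
    by (simp add: r_def)
  \<comment> \<open>Both interpolation weights are nonnegative because x and y lie in
    [0, d].\<close>
  then have "d * (smoothing_deriv f d y - smoothing_deriv f d x) \<le> 0"
    using xy q smoothing_deriv_diff[OF d, of x y f]
    by (auto intro!: mult_nonneg_nonpos add_nonpos_nonpos)
  then show ?thesis using d by (simp add: mult_le_0_iff)
qed

text \<open>The condition \<open>nontriv\<close> excludes exactly A = B = 0, where the cubic is the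
  line w f(d) / d and its derivative is constant.\<close>

lemma smoothing_deriv_less:
  assumes d: "d > 0" and xy: "0 \<le> x" "x < y" "y \<le> d"
    and q: "deriv (deriv f) d \<le> 0"
    and ge: "deriv (deriv f) d \<ge> 2 / d * (deriv f d - f d / d)"
    and nontriv: "\<not> (deriv f d = f d / d \<and> deriv (deriv f) d = 0)"
  shows "smoothing_deriv f d y < smoothing_deriv f d x"
proof -
  define r where "r = 2 / d * (deriv f d - f d / d)"
  have "r \<noteq> 0 \<or> deriv (deriv f) d \<noteq> 0"
    using nontriv d by (auto simp: r_def)
  \<comment> \<open>With q = f''(d), 3 r - 2 q = 3 (r - q) + q has two nonpositive terms, so it
    could vanish only for r = q = 0.\<close>
  then have "3 * r - 2 * deriv (deriv f) d < 0"
    using ge q unfolding r_def[symmetric] by linarith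
  then have "6 / d * (deriv f d - f d / d) - 2 * deriv (deriv f) d < 0"
    by (simp add: r_def)
  \<comment> \<open>From x < y <= d the midpoint is below d, so the negative value at 0 gets a
    positive weight.\<close>
  then have "d * (smoothing_deriv f d y - smoothing_deriv f d x) < 0"
    using xy q smoothing_deriv_diff[OF d, of x y f]
    by (auto intro!: mult_pos_neg add_neg_nonpos mult_nonneg_nonpos)
  then show ?thesis using d by (simp add: mult_less_0_iff)
qed

section \<open>Gluing the two ranges at the joint\<close>

lemma antimono_on_smoothing_deriv:
  assumes d: "d > 0" and q: "deriv (deriv f) d \<le> 0"
    and ge: "deriv (deriv f) d \<ge> 2 / d * (deriv f d - f d / d)"
    and anti: "antimono_on {d..} (deriv f)"
  shows "antimono_on {0..} (smoothing_deriv f d)"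
proof (rule monotone_onI)
  fix x y :: real assume xy: "x \<in> {0..}" "y \<in> {0..}" "x \<le> y"
  have right: "smoothing_deriv f d v \<le> smoothing_deriv f d u" if "d \<le> u" "u \<le> v" for u v
    using anti that by (auto simp: monotone_on_def smoothing_deriv_def)
  note left = smoothing_deriv_le[OF d _ _ _ q ge]
  consider "y \<le> d" | "d \<le> x" | "x \<le> d" "d \<le> y" by linarith
  then show "smoothing_deriv f d y \<le> smoothing_deriv f d x"
  proof cases
    case 3
    then show ?thesis using left[of x d] right[of d y] xy by auto
  qed (use left[of x y] right[of x y] xy in auto)
qed

lemma strict_antimono_on_smoothing_deriv:
  assumes d: "d > 0" and q: "deriv (deriv f) d \<le> 0"
    and ge: "deriv (deriv f) d \<ge> 2 / d * (deriv f d - f d / d)"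
    and nontriv: "\<not> (deriv f d = f d / d \<and> deriv (deriv f) d = 0)"
    and anti: "strict_antimono_on {d..} (deriv f)"
  shows "strict_antimono_on {0..} (smoothing_deriv f d)"
proof (rule monotone_onI)
  fix x y :: real assume xy: "x \<in> {0..}" "y \<in> {0..}" "x < y"
  have right: "smoothing_deriv f d v < smoothing_deriv f d u" if "d \<le> u" "u < v" for u v
    using anti that by (auto simp: monotone_on_def smoothing_deriv_def)
  note left = smoothing_deriv_less[OF d _ _ _ q ge nontriv]
  \<comment> \<open>The last case is strict on both sides, so that each strict comparison with d has
    distinct endpoints.\<close>
  consider "y \<le> d" | "d \<le> x" | "x < d" "d < y" by linarith
  then show "smoothing_deriv f d y < smoothing_deriv f d x"
  proof cases
    case 3
    then show ?thesis using left[of x d] right[of d y] xy by auto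
  qed (use left[of x y] right[of x y] xy in auto)
qed

theorem theorem2:
  fixes f :: "real \<Rightarrow> real" and \<delta> :: real
  assumes "\<delta> > 0"
    and "strict_mono_on {\<delta>..} f"
    and "f differentiable_on {\<delta>..}"
    and "f 0 = 0"
    and "twice_differentiable_at f \<delta>"
    and "deriv (deriv f) \<delta> \<ge> 2 / \<delta> * (deriv f \<delta> - f \<delta> / \<delta>)"
  shows "(antimono_on {\<delta>..} (deriv f) \<longrightarrow>
            strict_mono_on {0..} (smoothing f \<delta>) \<and> concave_on {0..} (smoothing f \<delta>)) \<and>
         (strict_antimono_on {\<delta>..} (deriv f) \<longrightarrow>
            strict_mono_on {0..} (smoothing f \<delta>) \<and>
            (\<not> (deriv f \<delta> = f \<delta> / \<delta> \<and> deriv (deriv f) \<delta> = 0) \<longrightarrow>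
              strictly_concave_on {0..} (smoothing f \<delta>)))"
proof -
  \<comment> \<open>At \<delta> the hypothesis on the half-line is only one-sided; two-sided
    differentiability there comes from \<open>twice_differentiable_at\<close>.\<close>
  have f: "f differentiable (at w)" if "\<delta> \<le> w" for w
  proof (cases "w = \<delta>")
    case True
    then show ?thesis
      using assms(5) by (auto simp: twice_differentiable_at_def dest: eventually_nhds_x_imp_x)
  next
    case False
    then have "f differentiable (at w within {\<delta><..})" "w \<in> {\<delta><..}"
      using assms(3) that by (auto intro: differentiable_within_subset simp: differentiable_on_def)
    then show ?thesis by (metis at_within_open open_greaterThan)
  qed
  have g: "(smoothing f \<delta> has_real_derivative smoothing_deriv f \<delta> w) (at w)" for w
    by (rule has_real_derivative_smoothing[OF assms(1)]) (rule f)
  have q: "deriv (deriv f) \<delta> \<le> 0" if "antimono_on {\<delta>..} (deriv f)"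
    by (rule antimono_on_deriv_nonpos[OF _ that])
      (use assms(5) in \<open>simp add: twice_differentiable_at_def DERIV_deriv_iff_real_differentiable\<close>)
  have weak: "strict_mono_on {0..} (smoothing f \<delta>) \<and> concave_on {0..} (smoothing f \<delta>)"
    if anti: "antimono_on {\<delta>..} (deriv f)"
  proof
    have anti': "antimono_on {0..} (smoothing_deriv f \<delta>)"
      using antimono_on_smoothing_deriv[OF assms(1) q[OF anti] assms(6) anti] .
    show "concave_on {0..} (smoothing f \<delta>)"
      using concave_on_realI[OF _ g anti'] by simp
    \<comment> \<open>Moving w to \<open>max w \<delta>\<close> does not raise the antitone
      derivative and lands where it is f' > 0.\<close>
    have "smoothing_deriv f \<delta> w > 0" if w: "w \<in> {0..}" for w
    proof -
      have "0 < deriv f (max w \<delta>)"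
        by (rule deriv_pos_if_strict_mono_on_antimono_on[OF assms(2) f anti]) auto
      also have "deriv f (max w \<delta>) = smoothing_deriv f \<delta> (max w \<delta>)"
        by (simp add: smoothing_deriv_def)
      also have "\<dots> \<le> smoothing_deriv f \<delta> w"
        using anti' w by (auto simp: monotone_on_def)
      finally show ?thesis .
    qed
    then show "strict_mono_on {0..} (smoothing f \<delta>)"
      by (intro strict_mono_on_realI[OF _ g]) simp_all
  qed
  have "strict_mono_on {0..} (smoothing f \<delta>) \<and>
      (\<not> (deriv f \<delta> = f \<delta> / \<delta> \<and> deriv (deriv f) \<delta> = 0) \<longrightarrow>
        strictly_concave_on {0..} (smoothing f \<delta>))"
    if anti: "strict_antimono_on {\<delta>..} (deriv f)"
  proof -
    \<comment> \<open>The weakened form makes \<open>q\<close> and \<open>weak\<close> available in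
      the strict case.\<close>
    have anti': "antimono_on {\<delta>..} (deriv f)"
      using anti by (force simp: monotone_on_def le_less)
    then show ?thesis
      using weak strictly_concave_on_realI[OF _ g
          strict_antimono_on_smoothing_deriv[OF assms(1) q assms(6) _ anti]]
      by simp
  qed
  with weak show ?thesis by blast
qed

end
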